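(* Let $p$ be a prime, let $m\le n$ be positive integers, and let $F\colon\mathbb Z_p^n\to\mathbb Z_p^m$ be a compatible function. (a) If $m=n=1$, then $F$ is measure-preserving if and only if $F$ is bijective modulo $p^k$ for all $k=1,2,3,\ldots$; and $F$ is ergodic if and only if $F$ is transitive modulo $p^k$ for all $k=1,2,3,\ldots$. (b) For $n\ge m$, the function $F$ is measure-preserving if and only if $F$ is balanced modulo $p^k$ for all $k=1,2,3,\ldots$.
   Context: $\mathbb Z_p$ is the ring of $p$-adic integers with the $p$-adic metric; $\mathbb Z_p^n$ carries the maximum norm $\|\cdot\|_p$. A function $F\colon\mathbb Z_p^n\to\mathbb Z_p^m$ is compatible if it is Lipschitz with constant $1$: $\|F(x)-F(y)\|_p\le\|x-y\|_p$ for all $x,y$; equivalently, $x\equiv y\pmod{p^k}$ (componentwise) implies $F(x)\equiv F(y)\pmod{p^k}$ for all $k\ge1$. Such $F$ induces a well-defined map $\bar F_k=F\bmod p^k\colon(\mathbb Z/p^k\mathbb Z)^n\to(\mathbb Z/p^k\mathbb Z)^m$. For $m=n=1$: $F$ is bijective modulo $p^k$ if $\bar F_k$ is a permutation of $\mathbb Z/p^k\mathbb Z$, and transitive modulo $p^k$ if $\bar F_k$ is a permutation consisting of a single cycle. $F$ is balanced modulo $p^k$ if $\#\bar F_k^{-1}(v)$ is the same for all $v\in(\mathbb Z/p^k\mathbb Z)^m$. $\mu_p$ denotes the Haar measure on $\mathbb Z_p^n$ (resp. $\mathbb Z_p^m$) normalized to total mass $1$. $F$ is measure-preserving if $\mu_p(F^{-1}(M))=\mu_p(M)$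 for every measurable $M\subset\mathbb Z_p^m$. A map $F\colon\mathbb Z_p\to\mathbb Z_p$ is ergodic if it is measure-preserving and every measurable $A$ with $F^{-1}(A)=A$ has $\mu_p(A)\in\{0,1\}$. *)

theory Defs
  imports
    "HOL-Probability.Probability"
    "HOL-Algebra.Ring"
    "HOL-Number_Theory.Residues"
    "HOL-Combinatorics.Orbits"
begin

section \<open>The $p$-adic integers\<close>

text \<open>
  The ring of $p$-adic integers as the inverse limit of the rings of integers modulo $p^k$: an
  element \<open>x\<close> is a coherent sequence, and \<open>x k\<close> is the least non-negative residue of \<open>x\<close>
  modulo $p^k$.
\<close>

definition Zp :: "nat \<Rightarrow> (nat \<Rightarrow> int) ring" where
  "Zp p = \<lparr> carrier = {x. \<forall>k. x k \<in> {0..<int p ^ k} \<and> x (Suc k) mod int p ^ k = x k},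
            monoid.mult = (\<lambda>x y k. (x k * y k) mod int p ^ k),
            one = (\<lambda>k. 1 mod int p ^ k),
            zero = (\<lambda>k. 0),
            add = (\<lambda>x y k. (x k + y k) mod int p ^ k) \<rparr>"

text \<open>
  Here \<open>x k = 0\<close> means that $p^k$ divides \<open>x\<close>, so for non-zero \<open>x\<close> the \<open>LEAST\<close> term is the
  exponent of the largest power of $p$ dividing \<open>x\<close>.
\<close>

definition padic_norm :: "nat \<Rightarrow> (nat \<Rightarrow> int) \<Rightarrow> real" where
  "padic_norm p x =
     (if x = \<zero>\<^bsub>Zp p\<^esub> then 0 else 1 / real p ^ (LEAST k. x (Suc k) \<noteq> 0))"

section \<open>The space of vectors of $p$-adic integers\<close>

text \<open>Vectors of length \<open>n\<close> are extensional functions on \<open>{..<n}\<close>; only \<open>n > 0\<close> is meaningful.\<close>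

type_synonym padic_vec = "nat \<Rightarrow> nat \<Rightarrow> int"

definition Zpn :: "nat \<Rightarrow> nat \<Rightarrow> padic_vec set" where
  "Zpn p n = {..<n} \<rightarrow>\<^sub>E carrier (Zp p)"

definition vec_add :: "nat \<Rightarrow> nat \<Rightarrow> padic_vec \<Rightarrow> padic_vec \<Rightarrow> padic_vec" where
  "vec_add p n x y = (\<lambda>i\<in>{..<n}. x i \<oplus>\<^bsub>Zp p\<^esub> y i)"

definition vec_diff :: "nat \<Rightarrow> nat \<Rightarrow> padic_vec \<Rightarrow> padic_vec \<Rightarrow> padic_vec" where
  "vec_diff p n x y = (\<lambda>i\<in>{..<n}. x i \<ominus>\<^bsub>Zp p\<^esub> y i)"

definition vec_norm :: "nat \<Rightarrow> nat \<Rightarrow> padic_vec \<Rightarrow> real" where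
  "vec_norm p n x = Max ((\<lambda>i. padic_norm p (x i)) ` {..<n})"

text \<open>
  The locale \<open>Metric_space\<close> wants a distance that is non-negative and symmetric even off the
  carrier, hence the conditional.
\<close>

definition vec_dist :: "nat \<Rightarrow> nat \<Rightarrow> padic_vec \<Rightarrow> padic_vec \<Rightarrow> real" where
  "vec_dist p n x y =
     (if x \<in> Zpn p n \<and> y \<in> Zpn p n then vec_norm p n (vec_diff p n x y) else 0)"

definition Zpn_topology :: "nat \<Rightarrow> nat \<Rightarrow> padic_vec topology" where
  "Zpn_topology p n = Metric_space.mtopology (Zpn p n) (vec_dist p n)"

section \<open>Compatible functions and their reductions\<close>

definition compatible :: "nat \<Rightarrow> nat \<Rightarrow> nat \<Rightarrow> (padic_vec \<Rightarrow> padic_vec) \<Rightarrow> bool" where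
  "compatible p n m F \<longleftrightarrow>
     F \<in> Zpn p n \<rightarrow> Zpn p m \<and>
     (\<forall>x\<in>Zpn p n. \<forall>y\<in>Zpn p n.
        vec_norm p m (vec_diff p m (F x) (F y)) \<le> vec_norm p n (vec_diff p n x y))"

definition residue_vecs :: "nat \<Rightarrow> nat \<Rightarrow> nat \<Rightarrow> (nat \<Rightarrow> int) set" where
  "residue_vecs p k n = {..<n} \<rightarrow>\<^sub>E carrier (residue_ring (int p ^ k))"

definition reduce :: "nat \<Rightarrow> nat \<Rightarrow> padic_vec \<Rightarrow> (nat \<Rightarrow> int)" where
  "reduce k n x = (\<lambda>i\<in>{..<n}. x i k)"

text \<open>
  The map induced by \<open>F\<close> modulo $p^k$: the value at \<open>v\<close> is the common reduction of all \<open>F x\<close>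
  where \<open>x\<close> reduces to \<open>v\<close>; for compatible \<open>F\<close> the set below is a singleton.
\<close>

definition induced ::
    "nat \<Rightarrow> nat \<Rightarrow> nat \<Rightarrow> nat \<Rightarrow> (padic_vec \<Rightarrow> padic_vec) \<Rightarrow> (nat \<Rightarrow> int) \<Rightarrow> (nat \<Rightarrow> int)" where
  "induced p k n m F v =
     the_elem ((\<lambda>x. reduce k m (F x)) ` {x \<in> Zpn p n. reduce k n x = v})"

definition bijective_mod :: "nat \<Rightarrow> nat \<Rightarrow> nat \<Rightarrow> (padic_vec \<Rightarrow> padic_vec) \<Rightarrow> bool" where
  "bijective_mod p k n F \<longleftrightarrow>
     bij_betw (induced p k n n F) (residue_vecs p k n) (residue_vecs p k n)"

definition transitive_mod :: "nat \<Rightarrow> nat \<Rightarrow> nat \<Rightarrow> (padic_vec \<Rightarrow> padic_vec) \<Rightarrow> bool" where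
  "transitive_mod p k n F \<longleftrightarrow>
     bij_betw (induced p k n n F) (residue_vecs p k n) (residue_vecs p k n) \<and>
     cyclic_on (induced p k n n F) (residue_vecs p k n)"

definition balanced_mod :: "nat \<Rightarrow> nat \<Rightarrow> nat \<Rightarrow> nat \<Rightarrow> (padic_vec \<Rightarrow> padic_vec) \<Rightarrow> bool" where
  "balanced_mod p k n m F \<longleftrightarrow>
     (\<exists>c. \<forall>v\<in>residue_vecs p k m. card {u \<in> residue_vecs p k n. induced p k n m F u = v} = c)"

section \<open>Haar measure, measure preservation and ergodicity\<close>

text \<open>
  Normalized Haar measure: the translation-invariant Borel probability measure on the compact
  group of vectors. (Regularity is automatic on a compact metric space.) Existence and uniqueness
  are shown in \<open>normalized_haar_ex1\<close> below.
\<close>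

definition normalized_haar :: "nat \<Rightarrow> nat \<Rightarrow> padic_vec measure \<Rightarrow> bool" where
  "normalized_haar p n M \<longleftrightarrow>
     space M = Zpn p n \<and>
     sets M = sigma_sets (Zpn p n) {U. openin (Zpn_topology p n) U} \<and>
     emeasure M (space M) = 1 \<and>
     (\<forall>a\<in>Zpn p n. \<forall>A\<in>sets M. emeasure M (vec_add p n a ` A) = emeasure M A)"

definition haar :: "nat \<Rightarrow> nat \<Rightarrow> padic_vec measure" where
  "haar p n = (THE M. normalized_haar p n M)"

definition measure_preserving :: "'a measure \<Rightarrow> 'b measure \<Rightarrow> ('a \<Rightarrow> 'b) \<Rightarrow> bool" where
  "measure_preserving M N T \<longleftrightarrow>
     T \<in> measurable M N \<and> (\<forall>A\<in>sets N. emeasure M (T -` A \<inter> space M) = emeasure N A)"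

definition ergodic :: "'a measure \<Rightarrow> ('a \<Rightarrow> 'a) \<Rightarrow> bool" where
  "ergodic M T \<longleftrightarrow>
     measure_preserving M M T \<and>
     (\<forall>A\<in>sets M. T -` A \<inter> space M = A \<longrightarrow> emeasure M A \<in> {0, 1})"

section \<open>Existence and uniqueness of Haar measure\<close>

context
  fixes p :: nat
  assumes p_gt_1: "1 < p"
begin

lemma Zp_iff: "x \<in> carrier (Zp p) \<longleftrightarrow>
    (\<forall>k. 0 \<le> x k \<and> x k < int p ^ k \<and> x (Suc k) mod int p ^ k = x k)"
  by (auto simp: Zp_def)

lemma Zp_add: "(x \<oplus>\<^bsub>Zp p\<^esub> y) k = (x k + y k) mod int p ^ k"
  by (simp add: Zp_def)

lemma Zp_zero: "\<zero>\<^bsub>Zp p\<^esub> = (\<lambda>k. 0)"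
  by (simp add: Zp_def)

lemma Zp_mod:
  assumes "x \<in> carrier (Zp p)" "j \<le> k"
  shows "x k mod int p ^ j = x j"
  using assms(2)
proof (induction k rule: dec_induct)
  case base
  then show ?case using assms(1) by (auto simp: Zp_iff)
next
  case (step k)
  have "x (Suc k) mod int p ^ j = x (Suc k) mod int p ^ k mod int p ^ j"
    using step by (simp add: mod_mod_cancel le_imp_power_dvd)
  also have "\<dots> = x j" using assms(1) step by (simp add: Zp_iff)
  finally show ?case .
qed

lemma Zp_cohI:
  assumes "\<And>k. f (Suc k) mod int p ^ k = f k mod int p ^ k"
  shows "(\<lambda>k. f k mod int p ^ k) \<in> carrier (Zp p)"
  using p_gt_1 by (auto simp: Zp_iff mod_mod_cancel assms)

lemma cring_Zp: "cring (Zp p)"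
proof (rule cringI)
  have neg: "(\<lambda>k. (- x k) mod int p ^ k) \<in> carrier (Zp p)" if "x \<in> carrier (Zp p)" for x
    using that by (intro Zp_cohI mod_minus_cong) (auto simp: Zp_iff)
  have add: "x \<oplus>\<^bsub>Zp p\<^esub> y \<in> carrier (Zp p)"
    if "x \<in> carrier (Zp p)" "y \<in> carrier (Zp p)" for x y
  proof -
    have "(\<lambda>k. (x k + y k) mod int p ^ k) \<in> carrier (Zp p)"
      using that by (intro Zp_cohI mod_add_cong) (auto simp: Zp_iff)
    then show ?thesis by (simp add: Zp_def)
  qed
  show "abelian_group (Zp p)"
  proof (rule abelian_groupI)
    fix x assume x: "x \<in> carrier (Zp p)"
    show "\<exists>y\<in>carrier (Zp p). y \<oplus>\<^bsub>Zp p\<^esub> x = \<zero>\<^bsub>Zp p\<^esub>"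
      using neg[OF x] by (intro bexI[OF _ neg[OF x]]) (simp add: Zp_def mod_simps)
    show "\<zero>\<^bsub>Zp p\<^esub> \<oplus>\<^bsub>Zp p\<^esub> x = x"
      using x by (auto simp: Zp_def)
  next
    show "\<zero>\<^bsub>Zp p\<^esub> \<in> carrier (Zp p)" using p_gt_1 by (simp add: Zp_def)
  qed (auto simp: add, auto simp: Zp_def mod_simps algebra_simps)
  have mult: "x \<otimes>\<^bsub>Zp p\<^esub> y \<in> carrier (Zp p)"
    if "x \<in> carrier (Zp p)" "y \<in> carrier (Zp p)" for x y
  proof -
    have "(\<lambda>k. (x k * y k) mod int p ^ k) \<in> carrier (Zp p)"
      using that by (intro Zp_cohI mod_mult_cong) (auto simp: Zp_iff)
    then show ?thesis by (simp add: Zp_def)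
  qed
  have one: "\<one>\<^bsub>Zp p\<^esub> \<in> carrier (Zp p)"
    using Zp_cohI[of "\<lambda>k. 1"] by (simp add: Zp_def)
  show "Group.comm_monoid (Zp p)"
  proof (rule comm_monoidI)
    fix x assume x: "x \<in> carrier (Zp p)"
    show "\<one>\<^bsub>Zp p\<^esub> \<otimes>\<^bsub>Zp p\<^esub> x = x"
      using x by (auto simp: Zp_def mod_simps)
  qed (auto simp: mult one, auto simp: Zp_def mod_simps algebra_simps)
  show "(x \<oplus>\<^bsub>Zp p\<^esub> y) \<otimes>\<^bsub>Zp p\<^esub> z = x \<otimes>\<^bsub>Zp p\<^esub> z \<oplus>\<^bsub>Zp p\<^esub> y \<otimes>\<^bsub>Zp p\<^esub> z" for x y z
    by (auto simp: Zp_def mod_simps algebra_simps)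
qed

interpretation Zp: cring "Zp p" by (rule cring_Zp)

lemma Zp_a_inv:
  assumes x: "x \<in> carrier (Zp p)"
  shows "(\<ominus>\<^bsub>Zp p\<^esub> x) k = (- x k) mod int p ^ k"
proof -
  have n: "(\<lambda>k. (- x k) mod int p ^ k) \<in> carrier (Zp p)"
    using x by (intro Zp_cohI mod_minus_cong) (auto simp: Zp_iff)
  have "\<ominus>\<^bsub>Zp p\<^esub> x = (\<lambda>k. (- x k) mod int p ^ k)"
    by (rule Zp.minus_equality[OF _ x n]) (simp add: Zp_def mod_simps)
  then show ?thesis by simp
qed

lemma Zp_minus:
  assumes "x \<in> carrier (Zp p)" "y \<in> carrier (Zp p)"
  shows "(x \<ominus>\<^bsub>Zp p\<^esub> y) k = (x k - y k) mod int p ^ k"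
  using assms by (simp add: a_minus_def Zp_add Zp_a_inv mod_simps)

lemma padic_norm_cases: "padic_norm p x = 0 \<or> (\<exists>k. padic_norm p x = 1 / real p ^ k)"
  by (auto simp: padic_norm_def)

lemma padic_norm_le_iff:
  assumes z: "z \<in> carrier (Zp p)"
  shows "padic_norm p z \<le> 1 / real p ^ k \<longleftrightarrow> z k = 0"
proof (cases "z = \<zero>\<^bsub>Zp p\<^esub>")
  case True
  then show ?thesis by (simp add: padic_norm_def Zp_zero)
next
  case False
  have z0: "z 0 = 0" using z[unfolded Zp_iff, rule_format, of 0] by simp
  have "\<exists>k. z (Suc k) \<noteq> 0"
  proof (rule ccontr)
    assume "\<not> ?thesis"
    then have "z k = 0" for k using z0 by (cases k) auto
    with False show False by (auto simp: Zp_zero)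
  qed
  then have L: "z (Suc (LEAST k. z (Suc k) \<noteq> 0)) \<noteq> 0" (is "z (Suc ?L) \<noteq> 0")
    by (rule LeastI_ex)
  have "z k = 0 \<longleftrightarrow> k \<le> ?L"
  proof
    assume "z k = 0"
    then have "z j = 0" if "j \<le> k" for j using Zp_mod[OF z that] by simp
    with L show "k \<le> ?L" by (meson not_less_eq_eq)
  next
    assume k: "k \<le> ?L"
    show "z k = 0"
    proof (cases k)
      case 0 then show ?thesis using z0 by simp
    next
      case (Suc j)
      then have "j < ?L" using k by simp
      from not_less_Least[OF this] show ?thesis using Suc by simp
    qed
  qed
  moreover have "padic_norm p z \<le> 1 / real p ^ k \<longleftrightarrow> k \<le> ?L"
    using False p_gt_1 by (simp add: padic_norm_def field_simps)
  ultimately show ?thesis by simp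
qed

lemma padic_dist_le_iff:
  assumes x: "x \<in> carrier (Zp p)" and y: "y \<in> carrier (Zp p)"
  shows "padic_norm p (x \<ominus>\<^bsub>Zp p\<^esub> y) \<le> 1 / real p ^ k \<longleftrightarrow> x k = y k"
proof -
  have "padic_norm p (x \<ominus>\<^bsub>Zp p\<^esub> y) \<le> 1 / real p ^ k \<longleftrightarrow> (x k - y k) mod int p ^ k = 0"
    using x y by (subst padic_norm_le_iff) (auto simp: Zp_minus)
  also have "\<dots> \<longleftrightarrow> x k mod int p ^ k = y k mod int p ^ k"
    by (metis mod_eq_dvd_iff mod_eq_0_iff_dvd)
  also have "\<dots> \<longleftrightarrow> x k = y k" using x y by (simp add: Zp_iff)
  finally show ?thesis .
qed

lemma ZpnD: "x \<in> Zpn p n \<Longrightarrow> i < n \<Longrightarrow> x i \<in> carrier (Zp p)"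
  by (auto simp: Zpn_def)

lemma vec_dist_le_iff:
  assumes n: "0 < n" and x: "x \<in> Zpn p n" and y: "y \<in> Zpn p n"
  shows "vec_dist p n x y \<le> 1 / real p ^ k \<longleftrightarrow> reduce k n x = reduce k n y"
proof -
  have "vec_dist p n x y \<le> 1 / real p ^ k \<longleftrightarrow>
      (\<forall>i<n. padic_norm p (vec_diff p n x y i) \<le> 1 / real p ^ k)"
  proof -
    have "{..<n} \<noteq> {}" using n by auto
    then show ?thesis using x y by (simp add: vec_dist_def vec_norm_def Max_le_iff) (auto)
  qed
  also have "\<dots> \<longleftrightarrow> (\<forall>i<n. x i k = y i k)"
    using x y by (auto simp: vec_diff_def padic_dist_le_iff ZpnD)
  also have "\<dots> \<longleftrightarrow> reduce k n x = reduce k n y"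
    by (auto simp: reduce_def fun_eq_iff restrict_def)
  finally show ?thesis .
qed

lemma vec_dist_cases:
  assumes n: "0 < n"
  shows "vec_dist p n x y = 0 \<or> (\<exists>k. vec_dist p n x y = 1 / real p ^ k)"
proof -
  have "vec_norm p n z \<in> (\<lambda>i. padic_norm p (z i)) ` {..<n}" for z
    unfolding vec_norm_def using n by (intro Max_in) auto
  then have "vec_norm p n z = 0 \<or> (\<exists>k. vec_norm p n z = 1 / real p ^ k)" for z
    using padic_norm_cases by (metis (no_types, lifting) imageE)
  then show ?thesis by (auto simp: vec_dist_def)
qed

lemma vec_dist_nonneg: "0 < n \<Longrightarrow> 0 \<le> vec_dist p n x y"
  using vec_dist_cases[of n x y] by auto

lemma reduce_eqI:
  assumes x: "x \<in> Zpn p n" and y: "y \<in> Zpn p n" and "\<And>k. reduce k n x = reduce k n y"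
  shows "x = y"
proof (rule PiE_ext[OF x[unfolded Zpn_def] y[unfolded Zpn_def]])
  fix i assume "i \<in> {..<n}"
  then have "x i k = y i k" for k
    using fun_cong[OF assms(3)[of k], of i] by (simp add: reduce_def)
  then show "x i = y i" ..
qed

lemma vec_dist_eq_0_iff:
  assumes n: "0 < n" and x: "x \<in> Zpn p n" and y: "y \<in> Zpn p n"
  shows "vec_dist p n x y = 0 \<longleftrightarrow> x = y"
proof
  assume "vec_dist p n x y = 0"
  then have "vec_dist p n x y \<le> 1 / real p ^ k" for k by simp
  then show "x = y" using vec_dist_le_iff[OF n x y] reduce_eqI[OF x y] by blast
next
  assume "x = y"
  then have *: "vec_dist p n x y \<le> 1 / real p ^ k" for k using vec_dist_le_iff[OF n x y] by blast
  show "vec_dist p n x y = 0"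
  proof (rule ccontr)
    assume "vec_dist p n x y \<noteq> 0"
    then obtain k where "vec_dist p n x y = 1 / real p ^ k" using vec_dist_cases[OF n] by blast
    with *[of "Suc k"] p_gt_1 show False by (simp add: field_simps)
  qed
qed

lemma vec_dist_commute: "0 < n \<Longrightarrow> vec_dist p n x y = vec_dist p n y x"
proof (cases "x \<in> Zpn p n \<and> y \<in> Zpn p n")
  case True
  assume n: "0 < n"
  have "vec_dist p n x y \<le> vec_dist p n y x" if "x \<in> Zpn p n" "y \<in> Zpn p n" for x y
  proof (cases "vec_dist p n y x = 0")
    case True
    then show ?thesis using vec_dist_eq_0_iff[OF n] that by force
  next
    case False
    then obtain k where "vec_dist p n y x = 1 / real p ^ k" using vec_dist_cases[OF n] by blast
    then show ?thesis using vec_dist_le_iff[OF n] that by (metis order_refl)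
  qed
  then show ?thesis using True by (simp add: order_antisym)
qed (auto simp: vec_dist_def)

lemma Metric_space_Zpn:
  assumes n: "0 < n"
  shows "Metric_space (Zpn p n) (vec_dist p n)"
proof
  fix x y z assume x: "x \<in> Zpn p n" and y: "y \<in> Zpn p n" and z: "z \<in> Zpn p n"
  show "vec_dist p n x y = 0 \<longleftrightarrow> x = y" by (rule vec_dist_eq_0_iff[OF n x y])
  define r where "r = max (vec_dist p n x y) (vec_dist p n y z)"
  have "vec_dist p n x z \<le> r"
  proof (cases "r = 0")
    case True
    then have "vec_dist p n x y = 0" "vec_dist p n y z = 0"
      using vec_dist_nonneg[OF n, of x y] vec_dist_nonneg[OF n, of y z] by (auto simp: r_def)
    then show ?thesis using True vec_dist_eq_0_iff[OF n] x y z by force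
  next
    case False
    then obtain k where k: "r = 1 / real p ^ k"
      using vec_dist_cases[OF n] unfolding r_def max_def by metis
    have "vec_dist p n x y \<le> 1 / real p ^ k" "vec_dist p n y z \<le> 1 / real p ^ k"
      by (auto simp flip: k simp: r_def)
    then show ?thesis unfolding k using vec_dist_le_iff[OF n] x y z by simp
  qed
  then show "vec_dist p n x z \<le> vec_dist p n x y + vec_dist p n y z"
    using vec_dist_nonneg[OF n, of x y] vec_dist_nonneg[OF n, of y z] by (auto simp: r_def)
qed (use n vec_dist_nonneg vec_dist_commute in auto)

lemma openin_Zpn_iff:
  assumes n: "0 < n"
  shows "openin (Zpn_topology p n) U \<longleftrightarrow>
    U \<subseteq> Zpn p n \<and> (\<forall>x\<in>U. \<exists>k. {y \<in> Zpn p n. reduce k n y = reduce k n x} \<subseteq> U)"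
proof -
  interpret Metric_space "Zpn p n" "vec_dist p n" by (rule Metric_space_Zpn[OF n])
  have cyl: "{y \<in> Zpn p n. reduce k n y = reduce k n x} = mcball x (1 / real p ^ k)"
    if "x \<in> Zpn p n" for x k
    using that vec_dist_le_iff[OF n] by auto
  have "(\<exists>r>0. mball x r \<subseteq> U) \<longleftrightarrow> (\<exists>k. {y \<in> Zpn p n. reduce k n y = reduce k n x} \<subseteq> U)"
    if x: "x \<in> Zpn p n" for x
  proof
    assume "\<exists>r>0. mball x r \<subseteq> U"
    then obtain r where r: "r > 0" "mball x r \<subseteq> U" by blast
    obtain k where "(1 / real p) ^ k < r"
      using real_arch_pow_inv[OF r(1), of "1 / real p"] p_gt_1 by auto
    then have "mcball x (1 / real p ^ k) \<subseteq> mball x r"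
      by (intro mcball_subset_mball_concentric) (simp add: power_divide)
    then show "\<exists>k. {y \<in> Zpn p n. reduce k n y = reduce k n x} \<subseteq> U"
      using r(2) cyl[OF x] by blast
  next
    assume "\<exists>k. {y \<in> Zpn p n. reduce k n y = reduce k n x} \<subseteq> U"
    then obtain k where "mcball x (1 / real p ^ k) \<subseteq> U" using cyl[OF x] by blast
    then have "mball x (1 / real p ^ k) \<subseteq> U" using mball_subset_mcball by blast
    then show "\<exists>r>0. mball x r \<subseteq> U"
      using p_gt_1 by (intro exI[of _ "1 / real p ^ k"]) auto
  qed
  then show ?thesis
    unfolding Zpn_topology_def openin_mtopology by (auto simp: subset_iff)
qed

definition cyls :: "nat \<Rightarrow> padic_vec set set" where
  "cyls n = {{x \<in> Zpn p n. reduce k n x = v} | k v. v \<in> residue_vecs p k n}"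

lemma residue_vecs_eq: "residue_vecs p k n = {..<n} \<rightarrow>\<^sub>E {0..<int p ^ k}"
proof -
  have "carrier (residue_ring (int p ^ k)) = {0..<int p ^ k}"
    unfolding residue_ring_def by auto
  then show ?thesis by (simp only: residue_vecs_def)
qed

lemma finite_residue_vecs: "finite (residue_vecs p k n)"
  by (simp add: residue_vecs_eq finite_PiE)

lemma card_residue_vecs: "card (residue_vecs p k n) = (p ^ n) ^ k"
  by (simp add: residue_vecs_eq card_PiE power_mult[symmetric] mult.commute flip: of_nat_power)

lemma reduce_in_residue_vecs: "x \<in> Zpn p n \<Longrightarrow> reduce k n x \<in> residue_vecs p k n"
  by (auto simp: reduce_def residue_vecs_eq Zpn_def Zp_iff Pi_iff PiE_iff)

lemma reduce_mono:
  assumes "x \<in> Zpn p n" "y \<in> Zpn p n" "j \<le> k" "reduce k n x = reduce k n y"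
  shows "reduce j n x = reduce j n y"
proof
  fix i
  show "reduce j n x i = reduce j n y i"
  proof (cases "i < n")
    case True
    then have "x i k = y i k" using fun_cong[OF assms(4), of i] by (simp add: reduce_def)
    then show ?thesis
      using True Zp_mod[OF ZpnD[OF assms(1) True] assms(3)] Zp_mod[OF ZpnD[OF assms(2) True] assms(3)]
      by (simp add: reduce_def)
  qed (simp add: reduce_def)
qed

lemma lift_residue_vec:
  assumes v: "v \<in> residue_vecs p k n"
  defines "x \<equiv> (\<lambda>i\<in>{..<n}. \<lambda>j. v i mod int p ^ j)"
  shows "x \<in> Zpn p n" "reduce k n x = v"
proof -
  show "x \<in> Zpn p n" by (auto simp: x_def Zpn_def intro!: Zp_cohI)
  show "reduce k n x = v"
    using v by (auto simp: x_def reduce_def residue_vecs_eq PiE_iff extensional_def fun_eq_iff)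
qed

lemma countable_cyls: "countable (cyls n)"
proof -
  have "cyls n \<subseteq> (\<Union>k. (\<lambda>v. {x \<in> Zpn p n. reduce k n x = v}) ` residue_vecs p k n)"
    by (auto simp: cyls_def)
  then show ?thesis
    by (rule countable_subset) (auto intro: countable_finite finite_residue_vecs)
qed

lemma cyls_subset: "cyls n \<subseteq> Pow (Zpn p n)"
  by (auto simp: cyls_def)

lemma reduce_0: "x \<in> Zpn p n \<Longrightarrow> reduce 0 n x = (\<lambda>i\<in>{..<n}. 0)"
proof -
  assume x: "x \<in> Zpn p n"
  have "x i 0 = 0" if "i < n" for i
    using ZpnD[OF x that, unfolded Zp_iff, rule_format, of 0] by simp
  then show ?thesis by (auto simp: reduce_def)
qed

lemma Zpn_in_cyls: "Zpn p n \<in> cyls n"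
proof -
  have "{x \<in> Zpn p n. reduce 0 n x = (\<lambda>i\<in>{..<n}. 0)} = Zpn p n"
    using reduce_0 by blast
  moreover have "(\<lambda>i\<in>{..<n}. 0) \<in> residue_vecs p 0 n" by (auto simp: residue_vecs_eq)
  ultimately show ?thesis unfolding cyls_def by blast
qed

lemma Int_stable_cyls: "Int_stable (insert {} (cyls n))"
proof -
  have *: "{x \<in> Zpn p n. reduce k n x = v} \<inter> {x \<in> Zpn p n. reduce l n x = w} \<in> insert {} (cyls n)"
    if "k \<le> l" "w \<in> residue_vecs p l n" for k l v w
  proof (cases "{x \<in> Zpn p n. reduce k n x = v} \<inter> {x \<in> Zpn p n. reduce l n x = w} = {}")
    case False
    then obtain y where y: "y \<in> Zpn p n" "reduce k n y = v" "reduce l n y = w" by blast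
    have "reduce k n x = v" if "x \<in> Zpn p n" "reduce l n x = w" for x
      using reduce_mono[OF that(1) y(1) \<open>k \<le> l\<close>] that y by simp
    then have "{x \<in> Zpn p n. reduce k n x = v} \<inter> {x \<in> Zpn p n. reduce l n x = w} =
        {x \<in> Zpn p n. reduce l n x = w}" by blast
    then show ?thesis using that(2) by (auto simp: cyls_def)
  qed simp
  show ?thesis
  proof (rule Int_stableI)
    fix A B assume AB: "A \<in> insert {} (cyls n)" "B \<in> insert {} (cyls n)"
    show "A \<inter> B \<in> insert {} (cyls n)"
    proof (cases "A = {} \<or> B = {}")
      case False
      then have "A \<in> cyls n" "B \<in> cyls n" using AB by auto
      then obtain k v l w where
        A: "A = {x \<in> Zpn p n. reduce k n x = v}" "v \<in> residue_vecs p k n" and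
        B: "B = {x \<in> Zpn p n. reduce l n x = w}" "w \<in> residue_vecs p l n"
        unfolding cyls_def by (elim CollectE exE conjE) (rule that)
      show ?thesis
      proof (cases "k \<le> l")
        case True
        then show ?thesis using *[of k l w v] A B by simp
      next
        case False
        then show ?thesis using *[of l k v w] A B by (simp add: Int_commute)
      qed
    qed auto
  qed
qed

lemma borel_Zpn_eq:
  assumes n: "0 < n"
  shows "sigma_sets (Zpn p n) {U. openin (Zpn_topology p n) U} = sigma_sets (Zpn p n) (cyls n)"
proof
  show "sigma_sets (Zpn p n) {U. openin (Zpn_topology p n) U} \<subseteq> sigma_sets (Zpn p n) (cyls n)"
  proof (rule sigma_sets_mono, rule subsetI)
    fix U assume "U \<in> {U. openin (Zpn_topology p n) U}"
    then have U: "U \<subseteq> Zpn p n" "\<And>x. x \<in> U \<Longrightarrow> \<exists>k. {y \<in> Zpn p n. reduce k n y = reduce k n x} \<subseteq> U"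
      by (auto simp: openin_Zpn_iff[OF n])
    have "U = \<Union>{C \<in> cyls n. C \<subseteq> U}"
    proof (intro equalityI subsetI)
      fix x assume x: "x \<in> U"
      then obtain k where k: "{y \<in> Zpn p n. reduce k n y = reduce k n x} \<subseteq> U" using U by blast
      have "{y \<in> Zpn p n. reduce k n y = reduce k n x} \<in> cyls n"
        using reduce_in_residue_vecs x U(1) unfolding cyls_def by blast
      then show "x \<in> \<Union>{C \<in> cyls n. C \<subseteq> U}" using k x U(1) by blast
    qed blast
    moreover have "\<Union>{C \<in> cyls n. C \<subseteq> U} \<in> sigma_sets (Zpn p n) (cyls n)"
      by (rule sigma_sets_UNION) (auto intro: countable_subset[OF _ countable_cyls[of n]])
    ultimately show "U \<in> sigma_sets (Zpn p n) (cyls n)" by simp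
  qed
  show "sigma_sets (Zpn p n) (cyls n) \<subseteq> sigma_sets (Zpn p n) {U. openin (Zpn_topology p n) U}"
  proof (rule sigma_sets_mono, rule subsetI)
    fix C assume "C \<in> cyls n"
    then obtain k v where C: "C = {x \<in> Zpn p n. reduce k n x = v}" by (auto simp: cyls_def)
    have "{y \<in> Zpn p n. reduce k n y = reduce k n x} \<subseteq> C" if "x \<in> C" for x
      using that unfolding C by simp
    then have "openin (Zpn_topology p n) C"
      unfolding openin_Zpn_iff[OF n] using C by blast
    then show "C \<in> sigma_sets (Zpn p n) {U. openin (Zpn_topology p n) U}" by auto
  qed
qed

lemma ZpnI:
  assumes "\<And>i. i < n \<Longrightarrow> f i \<in> carrier (Zp p)"
  shows "(\<lambda>i\<in>{..<n}. f i) \<in> Zpn p n"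
  unfolding Zpn_def restrict_PiE_iff using assms by simp

lemma vec_add_closed:
  assumes a: "a \<in> Zpn p n" and x: "x \<in> Zpn p n"
  shows "vec_add p n a x \<in> Zpn p n"
  unfolding vec_add_def
proof (rule ZpnI)
  fix i assume "i < n"
  then show "a i \<oplus>\<^bsub>Zp p\<^esub> x i \<in> carrier (Zp p)"
    using ZpnD[OF a] ZpnD[OF x] by (intro Zp.a_closed)
qed

lemma vec_neg:
  assumes a: "a \<in> Zpn p n"
  defines "b \<equiv> (\<lambda>i\<in>{..<n}. \<ominus>\<^bsub>Zp p\<^esub> a i)"
  shows "b \<in> Zpn p n" "x \<in> Zpn p n \<Longrightarrow> vec_add p n a (vec_add p n b x) = x"
    "x \<in> Zpn p n \<Longrightarrow> vec_add p n b (vec_add p n a x) = x"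
proof -
  show "b \<in> Zpn p n"
    unfolding b_def by (rule ZpnI) (rule Zp.a_inv_closed, rule ZpnD[OF a])
  have "a i \<oplus>\<^bsub>Zp p\<^esub> (b i \<oplus>\<^bsub>Zp p\<^esub> x i) = x i"
    "b i \<oplus>\<^bsub>Zp p\<^esub> (a i \<oplus>\<^bsub>Zp p\<^esub> x i) = x i"
    if "x \<in> Zpn p n" "i < n" for i
    using ZpnD[OF a that(2)] ZpnD[OF that] that(2) by (simp_all add: b_def Zp.r_neg2 Zp.r_neg1)
  then show "x \<in> Zpn p n \<Longrightarrow> vec_add p n a (vec_add p n b x) = x"
    "x \<in> Zpn p n \<Longrightarrow> vec_add p n b (vec_add p n a x) = x"
    by (auto simp: vec_add_def fun_eq_iff Zpn_def PiE_iff extensional_def)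
qed

lemma vec_add_vimage_cyl:
  assumes a: "a \<in> Zpn p n" and v: "v \<in> residue_vecs p k n"
  obtains w where "w \<in> residue_vecs p k n"
    "{x \<in> Zpn p n. reduce k n (vec_add p n a x) = v} = {x \<in> Zpn p n. reduce k n x = w}"
proof
  let ?w = "\<lambda>i\<in>{..<n}. (v i - a i k) mod int p ^ k"
  show "?w \<in> residue_vecs p k n" using p_gt_1 by (auto simp: residue_vecs_eq)
  have *: "(a i k + x i k) mod int p ^ k = v i \<longleftrightarrow> x i k = (v i - a i k) mod int p ^ k"
    if "i < n" "x \<in> Zpn p n" for i x
  proof -
    have x: "x i k mod int p ^ k = x i k" using ZpnD[OF that(2,1)] by (simp add: Zp_iff)
    have vi: "v i mod int p ^ k = v i" using v that(1) by (auto simp: residue_vecs_eq PiE_iff)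
    show ?thesis
    proof
      assume "(a i k + x i k) mod int p ^ k = v i"
      then have "(v i - a i k) mod int p ^ k = ((a i k + x i k) mod int p ^ k - a i k) mod int p ^ k"
        by simp
      also have "\<dots> = x i k" using x by (simp add: mod_simps)
      finally show "x i k = (v i - a i k) mod int p ^ k" ..
    next
      assume "x i k = (v i - a i k) mod int p ^ k"
      then have "(a i k + x i k) mod int p ^ k = (a i k + (v i - a i k) mod int p ^ k) mod int p ^ k"
        by simp
      also have "\<dots> = v i" using vi by (simp add: mod_simps)
      finally show "(a i k + x i k) mod int p ^ k = v i" .
    qed
  qed
  have ext: "reduce k n x = u \<longleftrightarrow> (\<forall>i<n. x i k = u i)" if "u \<in> extensional {..<n}" for x u
    using that by (auto simp: reduce_def fun_eq_iff extensional_def)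
  have "reduce k n (vec_add p n a x) = v \<longleftrightarrow> reduce k n x = ?w" if x: "x \<in> Zpn p n" for x
  proof -
    have "v \<in> extensional {..<n}" using v by (simp add: residue_vecs_eq PiE_iff)
    then have "reduce k n (vec_add p n a x) = v \<longleftrightarrow>
        (\<forall>i<n. (a i k + x i k) mod int p ^ k = v i)"
      by (simp add: ext vec_add_def Zp_add)
    also have "\<dots> \<longleftrightarrow> (\<forall>i<n. x i k = (v i - a i k) mod int p ^ k)"
      using *[OF _ x] by blast
    also have "\<dots> \<longleftrightarrow> reduce k n x = ?w" by (simp add: ext)
    finally show ?thesis .
  qed
  then show "{x \<in> Zpn p n. reduce k n (vec_add p n a x) = v} = {x \<in> Zpn p n. reduce k n x = ?w}"
    by blast
qed

lemma vec_add_image: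
  assumes a: "a \<in> Zpn p n" and A: "A \<subseteq> Zpn p n"
  shows "vec_add p n a ` A = {x \<in> Zpn p n. vec_add p n (\<lambda>i\<in>{..<n}. \<ominus>\<^bsub>Zp p\<^esub> a i) x \<in> A}"
    (is "_ = {x \<in> _. vec_add p n ?b x \<in> A}")
proof (intro equalityI subsetI)
  fix y assume "y \<in> vec_add p n a ` A"
  then show "y \<in> {x \<in> Zpn p n. vec_add p n ?b x \<in> A}"
    using A vec_add_closed[OF a] vec_neg(3)[OF a] by auto
next
  fix y assume y: "y \<in> {x \<in> Zpn p n. vec_add p n ?b x \<in> A}"
  then show "y \<in> vec_add p n a ` A"
    using vec_neg(2)[OF a, of y] by (intro image_eqI[of _ _ "vec_add p n ?b y"]) auto
qed

lemma haar_cylinder: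
  assumes n: "0 < n" and M: "normalized_haar p n M" and v: "v \<in> residue_vecs p k n"
  shows "emeasure M {x \<in> Zpn p n. reduce k n x = v} = 1 / ennreal (real ((p ^ n) ^ k))"
proof -
  let ?C = "\<lambda>v. {x \<in> Zpn p n. reduce k n x = v}"
  have sets: "?C w \<in> sets M" if "w \<in> residue_vecs p k n" for w
    using M that by (auto simp: normalized_haar_def borel_Zpn_eq[OF n] cyls_def)
  have shift: "emeasure M (?C w) = emeasure M (?C v)" if w: "w \<in> residue_vecs p k n" for w
  proof -
    define a where "a = vec_add p n (\<lambda>i\<in>{..<n}. \<lambda>j. w i mod int p ^ j)
      (\<lambda>i\<in>{..<n}. \<ominus>\<^bsub>Zp p\<^esub> (\<lambda>j. v i mod int p ^ j))"
    note lv = lift_residue_vec[OF v] and lw = lift_residue_vec[OF w]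
    let ?x = "\<lambda>i\<in>{..<n}. \<lambda>j. v i mod int p ^ j" and ?y = "\<lambda>i\<in>{..<n}. \<lambda>j. w i mod int p ^ j"
    have neg: "(\<lambda>i\<in>{..<n}. \<ominus>\<^bsub>Zp p\<^esub> ?x i) = (\<lambda>i\<in>{..<n}. \<ominus>\<^bsub>Zp p\<^esub> (\<lambda>j. v i mod int p ^ j))"
      by auto
    have a: "a \<in> Zpn p n"
      unfolding a_def using lw(1) vec_neg(1)[OF lv(1)] unfolding neg by (rule vec_add_closed)
    have ax: "vec_add p n a ?x = ?y"
      using lv(1) lw(1)
      by (auto simp: a_def vec_add_def Zpn_def PiE_iff fun_eq_iff Zp.a_assoc Zp.l_neg)
    obtain u where u: "u \<in> residue_vecs p k n"
      "{x \<in> Zpn p n. reduce k n (vec_add p n a x) = w} = ?C u"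
      using vec_add_vimage_cyl[OF a w] by blast
    have "?x \<in> ?C u" using lv(1) ax lw(2) unfolding u(2)[symmetric] by simp
    then have uv: "u = v" using lv(2) by simp
    have Cv: "?C v = {x \<in> Zpn p n. reduce k n (vec_add p n a x) = w}" using u(2) uv by simp
    have "vec_add p n a ` ?C v = ?C w"
    proof (intro equalityI subsetI)
      fix y assume "y \<in> ?C w"
      then have y: "y \<in> Zpn p n" "reduce k n y = w" by auto
      let ?z = "vec_add p n (\<lambda>i\<in>{..<n}. \<ominus>\<^bsub>Zp p\<^esub> a i) y"
      have z: "?z \<in> Zpn p n" "vec_add p n a ?z = y"
        using vec_add_closed[OF vec_neg(1)[OF a] y(1)] vec_neg(2)[OF a y(1)] by auto
      have "?z \<in> ?C v" unfolding Cv using z y(2) by simp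
      then show "y \<in> vec_add p n a ` ?C v" using imageI[of ?z "?C v" "vec_add p n a"] unfolding z(2) by blast
    next
      fix y assume "y \<in> vec_add p n a ` ?C v"
      then show "y \<in> ?C w" unfolding Cv using vec_add_closed[OF a] by blast
    qed
    moreover have "emeasure M (vec_add p n a ` ?C v) = emeasure M (?C v)"
      using M a sets[OF v] unfolding normalized_haar_def by blast
    ultimately show ?thesis by simp
  qed
  have "1 = emeasure M (Zpn p n)" using M unfolding normalized_haar_def by metis
  also have "Zpn p n = (\<Union>w\<in>residue_vecs p k n. ?C w)"
    using reduce_in_residue_vecs by auto
  also have "emeasure M \<dots> = (\<Sum>w\<in>residue_vecs p k n. emeasure M (?C w))"
    using sets by (intro sum_emeasure[symmetric] finite_residue_vecs)
      (auto simp: disjoint_family_on_def)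
  also have "\<dots> = (\<Sum>w\<in>residue_vecs p k n. emeasure M (?C v))"
    using shift by (intro sum.cong) auto
  also have "\<dots> = ennreal (real ((p ^ n) ^ k)) * emeasure M (?C v)"
    by (simp add: card_residue_vecs ennreal_of_nat_eq_real_of_nat)
  finally have eq: "1 = ennreal (real ((p ^ n) ^ k)) * emeasure M (?C v)" .
  have "emeasure M (?C v) * ennreal (real ((p ^ n) ^ k)) / ennreal (real ((p ^ n) ^ k)) =
      emeasure M (?C v)"
    using p_gt_1 by (intro ennreal_mult_divide_eq) auto
  then show ?thesis using eq by (simp only: mult.commute)
qed

text \<open>A measure giving the right mass to all residue classes is the Haar measure.\<close>

lemma normalized_haarI:
  assumes n: "0 < n" and sp: "space M = Zpn p n" and st: "sets M = sigma_sets (Zpn p n) (cyls n)"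
    and cyl: "\<And>k v. v \<in> residue_vecs p k n \<Longrightarrow>
      emeasure M {x \<in> Zpn p n. reduce k n x = v} = 1 / ennreal (real ((p ^ n) ^ k))"
  shows "normalized_haar p n M"
proof -
  have st': "sets M = sigma_sets (Zpn p n) (insert {} (cyls n))"
    unfolding st by (intro antisym sigma_sets_mono) (auto intro: sigma_sets.Empty)
  have one: "emeasure M (Zpn p n) = 1"
  proof -
    have "(\<lambda>i\<in>{..<n}. 0) \<in> residue_vecs p 0 n" by (auto simp: residue_vecs_eq)
    moreover have "{x \<in> Zpn p n. reduce 0 n x = (\<lambda>i\<in>{..<n}. 0)} = Zpn p n"
      using reduce_0 by blast
    ultimately show ?thesis using cyl[of "\<lambda>i\<in>{..<n}. 0" 0] by simp
  qed
  have meas: "vec_add p n a \<in> measurable M M" if a: "a \<in> Zpn p n" for a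
  proof (rule measurable_sigma_sets[OF st cyls_subset])
    show "vec_add p n a \<in> space M \<rightarrow> Zpn p n" using vec_add_closed[OF a] sp by auto
    fix C assume "C \<in> cyls n"
    then obtain k v where C: "C = {x \<in> Zpn p n. reduce k n x = v}" and v: "v \<in> residue_vecs p k n"
      by (auto simp: cyls_def)
    obtain w where w: "w \<in> residue_vecs p k n"
      "{x \<in> Zpn p n. reduce k n (vec_add p n a x) = v} = {x \<in> Zpn p n. reduce k n x = w}"
      by (rule vec_add_vimage_cyl[OF a v])
    have "vec_add p n a -` C \<inter> space M = {x \<in> Zpn p n. reduce k n x = w}"
      unfolding C sp w(2)[symmetric] using vec_add_closed[OF a] by auto
    then show "vec_add p n a -` C \<inter> space M \<in> sets M"
      using w(1) by (auto simp: st cyls_def)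
  qed
  have inv: "distr M M (vec_add p n a) = M" if a: "a \<in> Zpn p n" for a
  proof (rule measure_eqI_generator_eq[OF Int_stable_cyls])
    fix X assume X: "X \<in> insert {} (cyls n)"
    show "emeasure (distr M M (vec_add p n a)) X = emeasure M X"
    proof (cases "X = {}")
      case False
      then obtain k v where C: "X = {x \<in> Zpn p n. reduce k n x = v}" and v: "v \<in> residue_vecs p k n"
        using X by (auto simp: cyls_def)
      obtain w where w: "w \<in> residue_vecs p k n"
        "{x \<in> Zpn p n. reduce k n (vec_add p n a x) = v} = {x \<in> Zpn p n. reduce k n x = w}"
        by (rule vec_add_vimage_cyl[OF a v])
      have "vec_add p n a -` X \<inter> space M = {x \<in> Zpn p n. reduce k n x = w}"
        unfolding C sp w(2)[symmetric] using vec_add_closed[OF a] by auto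
      moreover have "X \<in> sets M" using X by (auto simp: st')
      ultimately show ?thesis using cyl[OF v] cyl[OF w(1)] C by (simp add: emeasure_distr meas[OF a])
    qed simp
  next
    show "range (\<lambda>i::nat. Zpn p n) \<subseteq> insert {} (cyls n)" using Zpn_in_cyls by auto
    have "Zpn p n \<in> sets M" using Zpn_in_cyls by (auto simp: st)
    moreover have "vec_add p n a -` Zpn p n \<inter> space M = Zpn p n"
      using vec_add_closed[OF a] unfolding sp by blast
    ultimately have "emeasure (distr M M (vec_add p n a)) (Zpn p n) = 1"
      using emeasure_distr[OF meas[OF a], of "Zpn p n"] one by simp
    then show "emeasure (distr M M (vec_add p n a)) (Zpn p n) \<noteq> \<infinity>" for i :: nat by simp
  qed (use cyls_subset st' in auto)
  show ?thesis
    unfolding normalized_haar_def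
  proof (intro conjI ballI)
    show "sets M = sigma_sets (Zpn p n) {U. openin (Zpn_topology p n) U}"
      by (simp add: st borel_Zpn_eq[OF n])
    fix a A assume a: "a \<in> Zpn p n" and A: "A \<in> sets M"
    let ?b = "\<lambda>i\<in>{..<n}. \<ominus>\<^bsub>Zp p\<^esub> a i"
    note b = vec_neg(1)[OF a]
    have "vec_add p n a ` A = vec_add p n ?b -` A \<inter> space M"
      using vec_add_image[OF a, of A] sets.sets_into_space[OF A] sp by auto
    then have "emeasure M (vec_add p n a ` A) = emeasure (distr M M (vec_add p n ?b)) A"
      using emeasure_distr[OF meas[OF b] A] by simp
    then show "emeasure M (vec_add p n a ` A) = emeasure M A" by (simp add: inv[OF b])
  qed (simp_all add: sp one)
qed

lemma digits_eq_iff: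
  assumes "\<And>j. j < k \<Longrightarrow> d j \<in> {0..<int p}"
  shows "(\<Sum>j<k. d j * int p ^ j) \<in> {0..<int p ^ k} \<and>
    (v \<in> {0..<int p ^ k} \<longrightarrow>
       (\<Sum>j<k. d j * int p ^ j) = v \<longleftrightarrow> (\<forall>j<k. d j = v div int p ^ j mod int p))"
  using assms
proof (induction k arbitrary: v)
  case (Suc k)
  let ?S = "\<Sum>j<k. d j * int p ^ j" and ?q = "int p ^ k"
  have q: "?q > 0" using p_gt_1 by simp
  have S: "0 \<le> ?S" "?S < ?q" using Suc by auto
  have dk: "0 \<le> d k" "d k < int p" using Suc.prems[of k] by auto
  have "?S + d k * ?q < ?q + d k * ?q" using S by simp
  also have "\<dots> = (d k + 1) * ?q" by (simp add: algebra_simps)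
  also have "\<dots> \<le> int p * ?q" using dk q by (intro mult_right_mono) auto
  finally have 1: "(\<Sum>j<Suc k. d j * int p ^ j) \<in> {0..<int p ^ Suc k}" using S dk by simp
  moreover have "(\<Sum>j<Suc k. d j * int p ^ j) = v \<longleftrightarrow> (\<forall>j<Suc k. d j = v div int p ^ j mod int p)"
    if v: "v \<in> {0..<int p ^ Suc k}"
  proof -
    have vk: "v div ?q mod int p = v div ?q"
    proof -
      have "v div ?q * ?q \<le> v" using div_mult_mod_eq[of v ?q] pos_mod_sign[OF q, of v] by linarith
      then have "v div ?q * ?q < int p * ?q" using v by simp
      then have "v div ?q < int p" using q by (simp only: mult_less_cancel_right_pos)
      moreover have "0 \<le> v div ?q" using v q by (simp add: pos_imp_zdiv_nonneg_iff)
      ultimately show ?thesis by simp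
    qed
    have "?S + d k * ?q = v \<longleftrightarrow> ?S = v mod ?q \<and> d k = v div ?q"
    proof
      assume v: "?S + d k * ?q = v"
      have "(?S + d k * ?q) div ?q = d k" "(?S + d k * ?q) mod ?q = ?S"
        using S q by (simp_all only: div_mult_self1 mod_mult_self1) auto
      then show "?S = v mod ?q \<and> d k = v div ?q" unfolding v by simp
    next
      assume "?S = v mod ?q \<and> d k = v div ?q"
      then show "?S + d k * ?q = v" by (simp add: mod_div_mult_eq)
    qed
    also have "?S = v mod ?q \<longleftrightarrow> (\<forall>j<k. d j = v mod ?q div int p ^ j mod int p)"
      using Suc q by auto
    also have "\<dots> \<longleftrightarrow> (\<forall>j<k. d j = v div int p ^ j mod int p)"
    proof -
      have "v mod ?q div int p ^ j mod int p = v div int p ^ j mod int p" if j: "j < k" for j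
      proof -
        obtain i where i: "k = j + Suc i" using less_imp_Suc_add[OF j] by auto
        have "v mod ?q div int p ^ j = v div int p ^ j mod int p ^ Suc i"
        proof -
          have "v mod (int p ^ j * int p ^ Suc i) =
              int p ^ j * (v div int p ^ j mod int p ^ Suc i) + v mod int p ^ j"
            by (rule zmod_zmult2_eq) simp
          moreover have "0 \<le> v mod int p ^ j" "v mod int p ^ j < int p ^ j"
            using p_gt_1 by auto
          then have "(v mod int p ^ j + int p ^ j * w) div int p ^ j = w" for w
            using p_gt_1 by (subst div_mult_self2) auto
          ultimately show ?thesis unfolding i power_add by (metis add.commute)
        qed
        then show ?thesis by (simp add: mod_mod_cancel)
      qed
      then show ?thesis by auto
    qed
    finally show ?thesis using vk by (auto simp: less_Suc_eq)
  qed
  ultimately show ?case by blast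
qed auto

text \<open>Existence: take independent, uniformly distributed base-\<open>p\<close> digits.\<close>

lemma normalized_haar_exists:
  assumes n: "0 < n"
  shows "\<exists>M. normalized_haar p n M"
proof -
  define D where "D = {..<n} \<rightarrow>\<^sub>E {0..<int p}"
  define U where "U = uniform_count_measure D"
  define P where "P = PiM (UNIV :: nat set) (\<lambda>_. U)"
  define \<phi> :: "(nat \<Rightarrow> nat \<Rightarrow> int) \<Rightarrow> padic_vec"
    where "\<phi> = (\<lambda>\<omega>. \<lambda>i\<in>{..<n}. \<lambda>k. \<Sum>j<k. \<omega> j i * int p ^ j)"
  have D: "finite D" "D \<noteq> {}" "card D = p ^ n"
    using p_gt_1 by (auto simp: D_def finite_PiE card_PiE PiE_eq_empty_iff)
  interpret U: prob_space U unfolding U_def by (rule prob_space_uniform_count_measure) fact+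
  interpret P: product_prob_space "\<lambda>_. U" UNIV ..
  have space_P: "space P = {\<omega>. \<forall>j. \<omega> j \<in> D}"
    by (auto simp: P_def space_PiM U_def space_uniform_count_measure PiE_iff)
  have dig: "\<omega> j i \<in> {0..<int p}" if "\<omega> \<in> space P" "i < n" for \<omega> j i
    using that by (auto simp: space_P D_def PiE_iff)
  have \<phi>: "\<phi> \<omega> \<in> Zpn p n" if \<omega>: "\<omega> \<in> space P" for \<omega>
  proof -
    have "(\<lambda>k. \<Sum>j<k. \<omega> j i * int p ^ j) \<in> carrier (Zp p)" if "i < n" for i
    proof -
      have "(\<Sum>j<k. \<omega> j i * int p ^ j) \<in> {0..<int p ^ k}" for k
        using digits_eq_iff[of k "\<lambda>j. \<omega> j i"] dig[OF \<omega> that] by blast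
      then show ?thesis by (auto simp: Zp_iff)
    qed
    then show ?thesis by (auto simp: \<phi>_def Zpn_def)
  qed
  have vim: "{\<omega> \<in> space P. reduce k n (\<phi> \<omega>) = v} =
      {\<omega> \<in> space P. \<forall>j\<in>{..<k}. \<omega> j \<in> {\<lambda>i\<in>{..<n}. v i div int p ^ j mod int p}}"
    if v: "v \<in> residue_vecs p k n" for k v
  proof -
    have "reduce k n (\<phi> \<omega>) = v \<longleftrightarrow> (\<forall>j<k. \<omega> j = (\<lambda>i\<in>{..<n}. v i div int p ^ j mod int p))"
      if \<omega>: "\<omega> \<in> space P" for \<omega>
    proof -
      have "reduce k n (\<phi> \<omega>) = v \<longleftrightarrow> (\<forall>i<n. (\<Sum>j<k. \<omega> j i * int p ^ j) = v i)"
        using v by (auto simp: reduce_def \<phi>_def residue_vecs_eq PiE_iff fun_eq_iff extensional_def)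
      also have "\<dots> \<longleftrightarrow> (\<forall>i<n. \<forall>j<k. \<omega> j i = v i div int p ^ j mod int p)"
      proof (intro all_cong1 imp_cong refl)
        fix i assume i: "i < n"
        have "v i \<in> {0..<int p ^ k}" using v i by (auto simp: residue_vecs_eq PiE_iff)
        then show "(\<Sum>j<k. \<omega> j i * int p ^ j) = v i \<longleftrightarrow> (\<forall>j<k. \<omega> j i = v i div int p ^ j mod int p)"
          using digits_eq_iff[of k "\<lambda>j. \<omega> j i" "v i"] dig[OF \<omega> i] by blast
      qed
      also have "\<dots> \<longleftrightarrow> (\<forall>j<k. \<omega> j = (\<lambda>i\<in>{..<n}. v i div int p ^ j mod int p))"
        using \<omega> by (auto simp: space_P D_def PiE_iff extensional_def fun_eq_iff)
      finally show ?thesis .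
    qed
    then show ?thesis by auto
  qed
  have digD: "(\<lambda>i\<in>{..<n}. v i div int p ^ j mod int p) \<in> D" for v j
    using p_gt_1 by (auto simp: D_def)
  have emU: "emeasure U {d} = 1 / ennreal (real (p ^ n))" if "d \<in> D" for d
    using that D p_gt_1 unfolding U_def
    by (subst emeasure_uniform_count_measure) (auto simp: divide_ennreal simp flip: ennreal_1)
  have setsU: "{d} \<in> sets U" if "d \<in> D" for d
    using that by (simp add: U_def sets_uniform_count_measure)
  define M where "M = distr P (sigma (Zpn p n) (cyls n)) \<phi>"
  have meas: "\<phi> \<in> measurable P (sigma (Zpn p n) (cyls n))"
  proof (rule measurable_measure_of[OF cyls_subset])
    show "\<phi> \<in> space P \<rightarrow> Zpn p n" using \<phi> by auto
    fix C assume "C \<in> cyls n"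
    then obtain k v where C: "C = {x \<in> Zpn p n. reduce k n x = v}" and v: "v \<in> residue_vecs p k n"
      by (auto simp: cyls_def)
    have "\<phi> -` C \<inter> space P = {\<omega> \<in> space P. reduce k n (\<phi> \<omega>) = v}" using \<phi> C by auto
    also have "\<dots> \<in> sets P"
      unfolding vim[OF v]
    proof (rule sets.sets_Collect_finite_All)
      fix j
      let ?d = "\<lambda>i\<in>{..<n}. v i div int p ^ j mod int p"
      have "(\<lambda>\<omega>. \<omega> j) \<in> measurable P U"
        unfolding P_def by (rule measurable_component_singleton) simp
      from measurable_sets[OF this setsU[OF digD]]
      show "{\<omega> \<in> space P. \<omega> j \<in> {?d}} \<in> sets P"
        by (simp add: vimage_def Int_def conj_commute)
    qed simp
    finally show "\<phi> -` C \<inter> space P \<in> sets P" .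
  qed
  have "normalized_haar p n M"
  proof (rule normalized_haarI[OF n])
    show "space M = Zpn p n" by (simp add: M_def cyls_subset)
    show "sets M = sigma_sets (Zpn p n) (cyls n)" by (simp add: M_def cyls_subset)
    fix k v assume v: "v \<in> residue_vecs p k n"
    have "emeasure M {x \<in> Zpn p n. reduce k n x = v} =
        emeasure P (\<phi> -` {x \<in> Zpn p n. reduce k n x = v} \<inter> space P)"
      unfolding M_def using v by (intro emeasure_distr[OF meas]) (auto simp: cyls_subset cyls_def)
    also have "\<phi> -` {x \<in> Zpn p n. reduce k n x = v} \<inter> space P =
        {\<omega> \<in> space P. reduce k n (\<phi> \<omega>) = v}" using \<phi> by auto
    also have "emeasure P \<dots> = (\<Prod>j<k. emeasure U {\<lambda>i\<in>{..<n}. v i div int p ^ j mod int p})"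
      unfolding vim[OF v] unfolding P_def
      by (rule P.emeasure_PiM_Collect) (auto simp: setsU digD)
    also have "\<dots> = (\<Prod>j<k. 1 / ennreal (real (p ^ n)))" by (simp add: emU digD)
    also have "\<dots> = 1 / ennreal (real ((p ^ n) ^ k))"
      using p_gt_1 by (simp add: divide_ennreal ennreal_power power_divide flip: ennreal_1)
    finally show "emeasure M {x \<in> Zpn p n. reduce k n x = v} = 1 / ennreal (real ((p ^ n) ^ k))" .
  qed
  then show ?thesis ..
qed

lemma normalized_haar_unique:
  assumes n: "0 < n" and M: "normalized_haar p n M" and N: "normalized_haar p n N"
  shows "M = N"
proof (rule measure_eqI_generator_eq[OF Int_stable_cyls])
  have eq: "sigma_sets (Zpn p n) (insert {} (cyls n)) =
      sigma_sets (Zpn p n) {U. openin (Zpn_topology p n) U}"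
    unfolding borel_Zpn_eq[OF n] by (intro antisym sigma_sets_mono) (auto intro: sigma_sets.Empty)
  show "sets M = sigma_sets (Zpn p n) (insert {} (cyls n))"
    "sets N = sigma_sets (Zpn p n) (insert {} (cyls n))"
    using M N by (auto simp: eq normalized_haar_def)
  fix X assume "X \<in> insert {} (cyls n)"
  then show "emeasure M X = emeasure N X"
    using haar_cylinder[OF n M] haar_cylinder[OF n N] by (auto simp: cyls_def)
next
  show "range (\<lambda>i::nat. Zpn p n) \<subseteq> insert {} (cyls n)" using Zpn_in_cyls by auto
  have "emeasure M (Zpn p n) = 1" using M unfolding normalized_haar_def by metis
  then show "emeasure M (Zpn p n) \<noteq> \<infinity>" for i :: nat by simp
qed (use cyls_subset in auto)

theorem normalized_haar_ex1: "0 < n \<Longrightarrow> \<exists>!M. normalized_haar p n M"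
  using normalized_haar_exists normalized_haar_unique by blast

theorem normalized_haar_haar: "0 < n \<Longrightarrow> normalized_haar p n (haar p n)"
  unfolding haar_def by (rule theI') (rule normalized_haar_ex1)

text \<open>The map induced modulo $p^k$ is well defined.\<close>

lemma induced_reduce:
  assumes F: "compatible p n m F" and nm: "0 < n" "0 < m" and x: "x \<in> Zpn p n"
  shows "induced p k n m F (reduce k n x) = reduce k m (F x)"
proof -
  have FV: "F y \<in> Zpn p m" if "y \<in> Zpn p n" for y
    using F that by (auto simp: compatible_def)
  have eq: "reduce k m (F y) = reduce k m (F x)"
    if y: "y \<in> Zpn p n" and red: "reduce k n y = reduce k n x" for y
  proof -
    have "vec_dist p m (F y) (F x) \<le> vec_dist p n y x"
      using F x y FV by (simp add: compatible_def vec_dist_def)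
    also have "\<dots> \<le> 1 / real p ^ k" using vec_dist_le_iff[OF nm(1) y x] red by blast
    finally show ?thesis using vec_dist_le_iff[OF nm(2) FV[OF y] FV[OF x]] by blast
  qed
  have "(\<lambda>y. reduce k m (F y)) ` {y \<in> Zpn p n. reduce k n y = reduce k n x} =
      {reduce k m (F x)}" (is "?g ` ?A = _")
  proof (intro equalityI subsetI)
    fix u assume "u \<in> ?g ` ?A"
    then show "u \<in> {reduce k m (F x)}" using eq by blast
  next
    fix u assume "u \<in> {reduce k m (F x)}"
    moreover have "x \<in> ?A" using x by simp
    ultimately show "u \<in> ?g ` ?A" by blast
  qed
  then show ?thesis by (simp only: induced_def the_elem_eq)
qed

end

end

theory Submission
  imports Defs
begin

text \<open>
  A compatible \<open>F\<close> pulls the residue class of \<open>v\<close> modulo $p^k$ back to the union of the classes of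
  the \<open>u\<close> with \<open>induced p k n m F u = v\<close>. As Haar measure is determined by its values on residue
  classes, \<open>F\<close> preserves it iff all these fibres have the right size. For ergodicity, the union of
  the classes in an orbit modulo $p^k$ is an invariant set, hence a proper orbit contradicts
  ergodicity. Conversely, if \<open>F\<close> is transitive modulo every $p^k$ and \<open>A\<close> is an invariant set of
  positive measure, then \<open>A\<close> occupies the same proportion of every residue class modulo $p^k$; so
  the measure conditioned on \<open>A\<close> is again the Haar measure, and \<open>A\<close> has measure 1.
\<close>

lemma measure_preserving_measure:
  assumes "measure_preserving M N T" "A \<in> sets N"
  shows "measure M (T -` A \<inter> space M) = measure N A"
  using assms unfolding measure_preserving_def measure_def by auto

context
  fixes p :: nat
  assumes p_gt_1: "1 < p"
begin

section \<open>Haar measure on unions of residue classes\<close>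

lemma space_haar: "0 < n \<Longrightarrow> space (haar p n) = Zpn p n"
  using normalized_haar_haar[OF p_gt_1] by (simp add: normalized_haar_def)

lemma sets_haar: "0 < n \<Longrightarrow> sets (haar p n) = sigma_sets (Zpn p n) (cyls p n)"
  using normalized_haar_haar[OF p_gt_1] borel_Zpn_eq[OF p_gt_1] by (simp add: normalized_haar_def)

lemma prob_space_haar: "0 < n \<Longrightarrow> prob_space (haar p n)"
  using normalized_haar_haar[OF p_gt_1] by (auto simp: normalized_haar_def intro: prob_spaceI)

text \<open>There are finitely many residue vectors modulo $p^k$, so this is a finite union of
  generators of the Borel sets.\<close>

lemma residue_classes_in_sets:
  assumes n: "0 < n" and S: "S \<subseteq> residue_vecs p k n"
  shows "{x \<in> Zpn p n. reduce k n x \<in> S} \<in> sets (haar p n)"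
proof -
  have "{x \<in> Zpn p n. reduce k n x \<in> S} = (\<Union>v\<in>S. {x \<in> Zpn p n. reduce k n x = v})"
    by auto
  moreover have "{x \<in> Zpn p n. reduce k n x = v} \<in> sets (haar p n)" if "v \<in> S" for v
    using that S by (auto simp: sets_haar[OF n] cyls_def[OF p_gt_1])
  ultimately show ?thesis
    using finite_subset[OF S finite_residue_vecs[OF p_gt_1]] by auto
qed

lemma measure_residue_classes:
  assumes n: "0 < n" and S: "S \<subseteq> residue_vecs p k n"
  shows "measure (haar p n) {x \<in> Zpn p n. reduce k n x \<in> S} = card S / real ((p ^ n) ^ k)"
proof -
  interpret prob_space "haar p n" by (rule prob_space_haar[OF n])
  have fin: "finite S" using finite_subset[OF S finite_residue_vecs[OF p_gt_1]] .
  have one: "measure (haar p n) {x \<in> Zpn p n. reduce k n x = v} = 1 / real ((p ^ n) ^ k)"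
    if "v \<in> S" for v
  proof -
    have "v \<in> residue_vecs p k n" using that S by blast
    note haar_cylinder[OF p_gt_1 n normalized_haar_haar[OF p_gt_1 n] this]
    also have "1 / ennreal (real ((p ^ n) ^ k)) = ennreal (1 / real ((p ^ n) ^ k))"
      using p_gt_1 by (simp add: divide_ennreal flip: ennreal_1)
    finally show ?thesis by (simp add: measure_def)
  qed
  have "{x \<in> Zpn p n. reduce k n x \<in> S} = (\<Union>v\<in>S. {x \<in> Zpn p n. reduce k n x = v})"
    by auto
  also have "measure (haar p n) \<dots> = (\<Sum>v\<in>S. measure (haar p n) {x \<in> Zpn p n. reduce k n x = v})"
  proof (rule finite_measure_finite_Union[OF fin])
    show "(\<lambda>v. {x \<in> Zpn p n. reduce k n x = v}) ` S \<subseteq> sets (haar p n)"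
      using residue_classes_in_sets[OF n, of "{v}" k for v] S by auto
  qed (auto simp: disjoint_family_on_def)
  also have "\<dots> = card S / real ((p ^ n) ^ k)" by (simp add: one)
  finally show ?thesis .
qed

text \<open>The tool for recognising Haar measure, with real-valued masses. It is applied to the
  image measure under \<open>F\<close> and to the measure conditioned on an invariant set.\<close>

lemma haar_eqI:
  assumes n: "0 < n" and sp: "space M = Zpn p n" and st: "sets M = sets (haar p n)"
    and "finite_measure M"
    and eq: "\<And>k v. v \<in> residue_vecs p k n \<Longrightarrow>
      measure M {x \<in> Zpn p n. reduce k n x = v} = 1 / real ((p ^ n) ^ k)"
  shows "M = haar p n"
proof -
  interpret finite_measure M by fact
  have "normalized_haar p n M"
  proof (rule normalized_haarI[OF p_gt_1 n sp])
    fix k v assume "v \<in> residue_vecs p k n"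
    then show "emeasure M {x \<in> Zpn p n. reduce k n x = v} = 1 / ennreal (real ((p ^ n) ^ k))"
      using p_gt_1 by (simp add: emeasure_eq_measure eq divide_ennreal flip: ennreal_1)
  qed (simp add: st sets_haar[OF n])
  then show ?thesis
    using normalized_haar_unique[OF p_gt_1 n] normalized_haar_haar[OF p_gt_1 n] by blast
qed

section \<open>Preimages of residue classes\<close>

lemma induced_closed:
  assumes "0 < n" "0 < m" "compatible p n m F" and u: "u \<in> residue_vecs p k n"
  shows "induced p k n m F u \<in> residue_vecs p k m"
proof -
  obtain x where x: "x \<in> Zpn p n" "reduce k n x = u"
    using lift_residue_vec[OF p_gt_1 u] by blast
  then have "F x \<in> Zpn p m" using assms by (auto simp: compatible_def)
  then show ?thesis
    using x induced_reduce[OF p_gt_1 assms(3,1,2) x(1), of k] reduce_in_residue_vecs[OF p_gt_1]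
    by simp
qed

text \<open>Reducing after \<open>F\<close> agrees with applying the induced map after reducing.
  Singletons \<open>S\<close> serve for measurability and counting, orbits for invariant
  sets.\<close>

lemma vimage_residue_classes:
  assumes "0 < n" "0 < m" "compatible p n m F"
  shows "F -` {y \<in> Zpn p m. reduce k m y \<in> S} \<inter> Zpn p n =
    {x \<in> Zpn p n. reduce k n x \<in> {u \<in> residue_vecs p k n. induced p k n m F u \<in> S}}"
  using assms induced_reduce[OF p_gt_1 assms(3,1,2)] reduce_in_residue_vecs[OF p_gt_1]
  by (auto simp: compatible_def)

text \<open>Measurability need only be checked on the generating residue classes, whose preimages
  are finite unions of residue classes.\<close>

lemma compatible_measurable:
  assumes nm: "0 < n" "0 < m" and F: "compatible p n m F"
  shows "F \<in> measurable (haar p n) (haar p m)"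
proof (rule measurable_sigma_sets[OF sets_haar[OF nm(2)] cyls_subset[OF p_gt_1]])
  show "F \<in> space (haar p n) \<rightarrow> Zpn p m" using F nm by (simp add: compatible_def space_haar)
  fix C assume "C \<in> cyls p m"
  then obtain k v where C: "C = {y \<in> Zpn p m. reduce k m y \<in> {v}}"
    by (auto simp: cyls_def[OF p_gt_1])
  show "F -` C \<inter> space (haar p n) \<in> sets (haar p n)"
    unfolding C space_haar[OF nm(1)] vimage_residue_classes[OF nm F]
    by (rule residue_classes_in_sets[OF nm(1)]) auto
qed

lemma measure_vimage_residue_class:
  assumes nm: "0 < n" "0 < m" and F: "compatible p n m F"
  shows "measure (haar p n) (F -` {y \<in> Zpn p m. reduce k m y = v} \<inter> Zpn p n) =
    card {u \<in> residue_vecs p k n. induced p k n m F u = v} / real ((p ^ n) ^ k)"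
  using vimage_residue_classes[OF nm F, of k "{v}"]
    measure_residue_classes[OF nm(1), of "{u \<in> residue_vecs p k n. induced p k n m F u = v}" k]
  by simp

section \<open>Measure preservation as a counting condition\<close>

text \<open>The preimage of a class consists of as many classes as the fibre has elements, so the
  equation compares its mass with that of the class. Clearing denominators keeps the condition in
  the natural numbers.\<close>

lemma measure_preserving_iff_card_fibres:
  assumes nm: "0 < n" "0 < m" and F: "compatible p n m F"
  shows "measure_preserving (haar p n) (haar p m) F \<longleftrightarrow>
    (\<forall>k. \<forall>v\<in>residue_vecs p k m.
      card {u \<in> residue_vecs p k n. induced p k n m F u = v} * (p ^ m) ^ k = (p ^ n) ^ k)"
    (is "_ \<longleftrightarrow> (\<forall>k. \<forall>v\<in>_. ?N k v * _ = _)")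
proof -
  interpret n: prob_space "haar p n" by (rule prob_space_haar[OF nm(1)])
  interpret m: prob_space "haar p m" by (rule prob_space_haar[OF nm(2)])
  note meas = compatible_measurable[OF nm F]
  have count: "?N k v / real ((p ^ n) ^ k) = 1 / real ((p ^ m) ^ k) \<longleftrightarrow>
      ?N k v * (p ^ m) ^ k = (p ^ n) ^ k" for k v
  proof -
    have "?N k v / real ((p ^ n) ^ k) = 1 / real ((p ^ m) ^ k) \<longleftrightarrow>
        real (?N k v * (p ^ m) ^ k) = real ((p ^ n) ^ k)"
      using p_gt_1 by (simp add: frac_eq_eq)
    then show ?thesis by (simp only: of_nat_eq_iff)
  qed
  show ?thesis
  proof
    assume mp: "measure_preserving (haar p n) (haar p m) F"
    show "\<forall>k. \<forall>v\<in>residue_vecs p k m. ?N k v * (p ^ m) ^ k = (p ^ n) ^ k"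
    proof (intro allI ballI)
      fix k v assume v: "v \<in> residue_vecs p k m"
      let ?C = "{y \<in> Zpn p m. reduce k m y = v}"
      have C: "?C \<in> sets (haar p m)"
        using residue_classes_in_sets[OF nm(2), of "{v}" k] v by simp
      have "measure (haar p n) (F -` ?C \<inter> Zpn p n) = measure (haar p m) ?C"
        using measure_preserving_measure[OF mp C] by (simp only: space_haar[OF nm(1)])
      moreover have "measure (haar p m) ?C = 1 / real ((p ^ m) ^ k)"
        using measure_residue_classes[OF nm(2), of "{v}" k] v by simp
      ultimately have "?N k v / real ((p ^ n) ^ k) = 1 / real ((p ^ m) ^ k)"
        by (simp only: measure_vimage_residue_class[OF nm F])
      then show "?N k v * (p ^ m) ^ k = (p ^ n) ^ k" by (simp only: count)
    qed
  next
    assume N: "\<forall>k. \<forall>v\<in>residue_vecs p k m. ?N k v * (p ^ m) ^ k = (p ^ n) ^ k"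
    \<comment> \<open>Agreement on residue classes makes the image measure Haar measure, which
      extends the equality to all measurable sets.\<close>
    have distr: "distr (haar p n) (haar p m) F = haar p m"
    proof (rule haar_eqI[OF nm(2)])
      show "finite_measure (distr (haar p n) (haar p m) F)"
        by (rule n.finite_measure_distr[OF meas])
      fix k v assume v: "v \<in> residue_vecs p k m"
      then have "{y \<in> Zpn p m. reduce k m y = v} \<in> sets (haar p m)"
        using residue_classes_in_sets[OF nm(2), of "{v}" k] by simp
      then have "measure (distr (haar p n) (haar p m) F) {y \<in> Zpn p m. reduce k m y = v} =
          ?N k v / real ((p ^ n) ^ k)"
        by (simp only: measure_distr[OF meas] space_haar[OF nm(1)]
            measure_vimage_residue_class[OF nm F])
      also have "\<dots> = 1 / real ((p ^ m) ^ k)" using N v by (simp only: count)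
      finally show "measure (distr (haar p n) (haar p m) F) {y \<in> Zpn p m. reduce k m y = v} =
          1 / real ((p ^ m) ^ k)" .
    qed (simp_all add: space_haar[OF nm(2)])
    show "measure_preserving (haar p n) (haar p m) F"
      unfolding measure_preserving_def using meas emeasure_distr[OF meas] distr by metis
  qed
qed

text \<open>The fibres partition the $p^{nk}$ residue vectors of the domain over the $p^{mk}$ of the
  codomain, which determines their common size.\<close>

lemma balanced_mod_iff_card_fibres:
  assumes nm: "0 < n" "0 < m" and F: "compatible p n m F"
  shows "balanced_mod p k n m F \<longleftrightarrow>
    (\<forall>v\<in>residue_vecs p k m.
      card {u \<in> residue_vecs p k n. induced p k n m F u = v} * (p ^ m) ^ k = (p ^ n) ^ k)"
    (is "_ \<longleftrightarrow> (\<forall>v\<in>_. ?N v * _ = _)")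
proof
  assume "balanced_mod p k n m F"
  then obtain c where c: "?N v = c" if "v \<in> residue_vecs p k m" for v
    by (auto simp: balanced_mod_def)
  have "(p ^ n) ^ k = card (residue_vecs p k n)" by (simp add: card_residue_vecs[OF p_gt_1])
  also have "residue_vecs p k n =
      (\<Union>v\<in>residue_vecs p k m. {u \<in> residue_vecs p k n. induced p k n m F u = v})"
    using induced_closed[OF nm F] by auto
  also have "card \<dots> = (\<Sum>v\<in>residue_vecs p k m. ?N v)"
    by (rule card_UN_disjoint) (auto simp: finite_residue_vecs[OF p_gt_1])
  also have "\<dots> = c * (p ^ m) ^ k" by (simp add: c card_residue_vecs[OF p_gt_1])
  finally show "\<forall>v\<in>residue_vecs p k m. ?N v * (p ^ m) ^ k = (p ^ n) ^ k" using c by simp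
next
  assume N: "\<forall>v\<in>residue_vecs p k m. ?N v * (p ^ m) ^ k = (p ^ n) ^ k"
  have "?N v = (p ^ n) ^ k div (p ^ m) ^ k" if "v \<in> residue_vecs p k m" for v
  proof -
    have "?N v * (p ^ m) ^ k div (p ^ m) ^ k = ?N v"
      using p_gt_1 by (intro nonzero_mult_div_cancel_right) simp
    then show ?thesis using N that by simp
  qed
  then show "balanced_mod p k n m F" unfolding balanced_mod_def by blast
qed

lemma measure_preserving_iff_balanced_mod:
  assumes nm: "0 < n" "0 < m" and F: "compatible p n m F"
  shows "measure_preserving (haar p n) (haar p m) F \<longleftrightarrow> (\<forall>k\<ge>1. balanced_mod p k n m F)"
proof -
  \<comment> \<open>The counting criterion also covers \<open>k = 0\<close>. Modulo 1 there is a
    single residue vector, so balance is automatic there.\<close>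
  have "balanced_mod p 0 n m F"
  proof -
    obtain v where "residue_vecs p 0 m = {v}"
      using card_residue_vecs[OF p_gt_1, of 0 m] by (auto simp: card_1_singleton_iff)
    then show ?thesis by (simp add: balanced_mod_def)
  qed
  then have "(\<forall>k\<ge>1. balanced_mod p k n m F) \<longleftrightarrow> (\<forall>k. balanced_mod p k n m F)"
    by (metis less_one not_le)
  then show ?thesis
    by (simp only: measure_preserving_iff_card_fibres[OF nm F] balanced_mod_iff_card_fibres[OF nm F])
qed

text \<open>In equal dimensions the common fibre size must be 1.\<close>

lemma balanced_mod_iff_bijective_mod:
  assumes n: "0 < n" and F: "compatible p n n F"
  shows "balanced_mod p k n n F \<longleftrightarrow> bijective_mod p k n F"
proof -
  let ?R = "residue_vecs p k n" and ?f = "induced p k n n F"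
  have f: "?f u \<in> ?R" if "u \<in> ?R" for u
    using induced_closed[OF n n F that] .
  have "balanced_mod p k n n F \<longleftrightarrow> (\<forall>v\<in>?R. card {u \<in> ?R. ?f u = v} = 1)"
    using p_gt_1 by (simp add: balanced_mod_iff_card_fibres[OF n n F])
  also have "\<dots> \<longleftrightarrow> (\<forall>v\<in>?R. \<exists>!u. u \<in> ?R \<and> ?f u = v)"
    by (simp only: is_singleton_altdef[symmetric] is_singleton_iff_ex1 mem_Collect_eq)
  also have "\<dots> \<longleftrightarrow> bij_betw ?f ?R ?R"
  proof
    assume ex1: "\<forall>v\<in>?R. \<exists>!u. u \<in> ?R \<and> ?f u = v"
    show "bij_betw ?f ?R ?R"
      unfolding bij_betw_def
    proof
      show "inj_on ?f ?R" using ex1 f by (intro inj_onI) metis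
      show "?f ` ?R = ?R" using ex1 f by blast
    qed
  next
    assume "bij_betw ?f ?R ?R"
    then have "inj_on ?f ?R" and im: "?f ` ?R = ?R" by (auto simp only: bij_betw_def)
    show "\<forall>v\<in>?R. \<exists>!u. u \<in> ?R \<and> ?f u = v"
    proof
      fix v assume "v \<in> ?R"
      then have "v \<in> ?f ` ?R" by (simp only: im)
      then show "\<exists>!u. u \<in> ?R \<and> ?f u = v"
        using inj_onD[OF \<open>inj_on ?f ?R\<close>] by (elim imageE) blast
    qed
  qed
  finally show ?thesis by (simp add: bijective_mod_def)
qed

lemma measure_preserving_iff_bijective_mod:
  assumes "0 < n" and "compatible p n n F"
  shows "measure_preserving (haar p n) (haar p n) F \<longleftrightarrow> (\<forall>k\<ge>1. bijective_mod p k n F)"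
  using assms by (simp add: measure_preserving_iff_balanced_mod balanced_mod_iff_bijective_mod)

section \<open>Ergodicity and transitivity\<close>

text \<open>An injection of a finite orbit into itself is onto, so by injectivity on
  \<open>R\<close> no point outside the orbit can be mapped into it. This turns forward invariance
  into the backward invariance that ergodicity speaks of.\<close>

lemma orbit_vimage_eq:
  assumes fin: "finite R" and bij: "bij_betw f R R" and u: "u \<in> R"
  shows "orbit f u \<subseteq> R" "{v \<in> R. f v \<in> orbit f u} = orbit f u"
proof -
  show sub: "orbit f u \<subseteq> R"
  proof
    fix v assume "v \<in> orbit f u"
    then show "v \<in> R" by induction (use bij u in \<open>auto dest: bij_betwE\<close>)
  qed
  have "f ` orbit f u = orbit f u"
  proof (rule card_subset_eq)
    show "finite (orbit f u)" using sub fin by (rule finite_subset)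
    show "card (f ` orbit f u) = card (orbit f u)"
      using bij sub by (intro card_image) (auto simp: bij_betw_def intro: inj_on_subset)
  qed (auto intro: orbit.step)
  then show "{v \<in> R. f v \<in> orbit f u} = orbit f u"
    using sub bij unfolding bij_betw_def inj_on_def by blast
qed

text \<open>The classes in one orbit form an invariant set whose mass is the share of residue
  vectors lying in that orbit. As the orbit is nonempty, ergodicity forces this share to be
  1.\<close>

lemma ergodic_imp_transitive_mod:
  assumes n: "0 < n" and F: "compatible p n n F" and erg: "ergodic (haar p n) F" and k: "k \<ge> 1"
  shows "transitive_mod p k n F"
proof -
  let ?R = "residue_vecs p k n" and ?f = "induced p k n n F"
  have bij: "bij_betw ?f ?R ?R"
    using erg k measure_preserving_iff_bijective_mod[OF n F]
    by (simp add: ergodic_def bijective_mod_def)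
  have "card ?R > 0" using p_gt_1 by (simp add: card_residue_vecs)
  then obtain u where u: "u \<in> ?R" by fastforce
  note O = orbit_vimage_eq[OF finite_residue_vecs[OF p_gt_1] bij u]
  let ?A = "{x \<in> Zpn p n. reduce k n x \<in> orbit ?f u}"
  have A: "?A \<in> sets (haar p n)" by (rule residue_classes_in_sets[OF n O(1)])
  have "F -` ?A \<inter> space (haar p n) = ?A"
    using vimage_residue_classes[OF n n F, of k "orbit ?f u"] by (simp only: O(2) space_haar[OF n])
  then have "emeasure (haar p n) ?A \<in> {0, 1}"
    using erg A unfolding ergodic_def by blast
  then have "measure (haar p n) ?A \<in> {0, 1}" by (auto simp: measure_def)
  then have "card (orbit ?f u) / real ((p ^ n) ^ k) \<in> {0, 1}"
    by (simp only: measure_residue_classes[OF n O(1)])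
  \<comment> \<open>The orbit contains the image of \<open>u\<close>, which rules out mass
    0.\<close>
  moreover have "card (orbit ?f u) > 0"
    using orbit.base finite_subset[OF O(1) finite_residue_vecs[OF p_gt_1]]
    by (metis card_gt_0_iff empty_iff)
  ultimately have "real (card (orbit ?f u)) = real ((p ^ n) ^ k)"
    using p_gt_1 by (auto simp: field_simps)
  then have "orbit ?f u = ?R"
    using O(1) by (intro card_subset_eq finite_residue_vecs[OF p_gt_1])
      (simp_all only: card_residue_vecs[OF p_gt_1] of_nat_eq_iff)
  then show ?thesis
    using bij u by (auto simp: transitive_mod_def cyclic_on_def)
qed

text \<open>Pulling back along \<open>F\<close> moves the part of \<open>A\<close> in one class to
  the part in the preceding class of the cycle without changing its mass. All parts thus have equal
  mass, and they add up to that of \<open>A\<close>.\<close>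

lemma measure_invariant_Int_residue_class:
  assumes n: "0 < n" and F: "compatible p n n F"
    and mp: "measure_preserving (haar p n) (haar p n) F" and trans: "transitive_mod p k n F"
    and A: "A \<in> sets (haar p n)" and inv: "F -` A \<inter> Zpn p n = A"
    and v: "v \<in> residue_vecs p k n"
  shows "measure (haar p n) (A \<inter> {x \<in> Zpn p n. reduce k n x = v}) =
    measure (haar p n) A / real ((p ^ n) ^ k)"
proof -
  interpret prob_space "haar p n" by (rule prob_space_haar[OF n])
  let ?R = "residue_vecs p k n" and ?f = "induced p k n n F"
  let ?C = "\<lambda>v. {x \<in> Zpn p n. reduce k n x = v}" and ?\<mu> = "measure (haar p n)"
  have bij: "bij_betw ?f ?R ?R" and cyc: "cyclic_on ?f ?R"
    using trans by (auto simp: transitive_mod_def)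
  have AC: "A \<inter> ?C v \<in> sets (haar p n)" if "v \<in> ?R" for v
    using A residue_classes_in_sets[OF n, of "{v}" k] that by auto
  have shift: "?\<mu> (A \<inter> ?C (?f w)) = ?\<mu> (A \<inter> ?C w)" if w: "w \<in> ?R" for w
  proof -
    have fw: "?f w \<in> ?R" using bij w by (auto dest: bij_betwE)
    \<comment> \<open>Injectivity of the induced map makes the preimage of a class a single
      class.\<close>
    have "{u \<in> ?R. ?f u \<in> {?f w}} = {w}"
      using bij w by (auto simp: bij_betw_def dest: inj_onD)
    then have "F -` ?C (?f w) \<inter> Zpn p n = ?C w"
      using vimage_residue_classes[OF n n F, of k "{?f w}"] by simp
    then have "F -` (A \<inter> ?C (?f w)) \<inter> space (haar p n) = A \<inter> ?C w"
      using inv unfolding space_haar[OF n] by blast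
    then show ?thesis using measure_preserving_measure[OF mp AC[OF fw]] by (simp only:)
  qed
  \<comment> \<open>Induction along the orbit of \<open>v\<close>, which is all of \<open>?R\<close>
    by transitivity.\<close>
  have const: "?\<mu> (A \<inter> ?C w) = ?\<mu> (A \<inter> ?C v)" if "w \<in> ?R" for w
  proof -
    have "w \<in> orbit ?f v" using orbit_cyclic_eq3[OF cyc v] that by simp
    then show ?thesis
    proof induction
      case base
      then show ?case by (rule shift[OF v])
    next
      case (step w)
      then have "w \<in> ?R" using orbit_cyclic_eq3[OF cyc v] by simp
      then show ?case using shift step.IH by simp
    qed
  qed
  have "A \<subseteq> Zpn p n" using inv by blast
  then have "A = (\<Union>w\<in>?R. A \<inter> ?C w)" using reduce_in_residue_vecs[OF p_gt_1] by auto
  then have "?\<mu> A = ?\<mu> (\<Union>w\<in>?R. A \<inter> ?C w)" by simp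
  also have "\<dots> = (\<Sum>w\<in>?R. ?\<mu> (A \<inter> ?C w))"
    using AC by (intro finite_measure_finite_Union finite_residue_vecs[OF p_gt_1])
      (auto simp: disjoint_family_on_def)
  also have "\<dots> = real ((p ^ n) ^ k) * ?\<mu> (A \<inter> ?C v)"
    by (simp add: const card_residue_vecs[OF p_gt_1])
  finally show ?thesis using p_gt_1 by (simp add: field_simps)
qed

text \<open>Equidistribution of an invariant set over all residue classes says that conditioning on
  it leaves the mass of every class unchanged.\<close>

lemma transitive_mod_imp_ergodic:
  assumes n: "0 < n" and F: "compatible p n n F" and trans: "\<And>k. k \<ge> 1 \<Longrightarrow> transitive_mod p k n F"
  shows "ergodic (haar p n) F"
proof -
  interpret prob_space "haar p n" by (rule prob_space_haar[OF n])
  let ?\<mu> = "measure (haar p n)"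
  have mp: "measure_preserving (haar p n) (haar p n) F"
    using trans by (auto simp: measure_preserving_iff_bijective_mod[OF n F] bijective_mod_def
        transitive_mod_def)
  have "emeasure (haar p n) A \<in> {0, 1}"
    if A: "A \<in> sets (haar p n)" and inv: "F -` A \<inter> space (haar p n) = A" for A
  proof (cases "emeasure (haar p n) A = 0")
    case False
    then have pos: "?\<mu> A \<noteq> 0" by (simp add: emeasure_eq_measure)
    interpret U: prob_space "uniform_measure (haar p n) A"
      using False by (intro prob_space_uniform_measure) (simp_all add: emeasure_eq_measure)
    have "uniform_measure (haar p n) A = haar p n"
    proof (rule haar_eqI[OF n])
      fix k v assume v: "v \<in> residue_vecs p k n"
      let ?C = "{x \<in> Zpn p n. reduce k n x = v}"
      have C: "?C \<in> sets (haar p n)"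
        using residue_classes_in_sets[OF n, of "{v}" k] v by simp
      have "?\<mu> (A \<inter> ?C) = ?\<mu> A / real ((p ^ n) ^ k)"
      \<comment> \<open>Transitivity is assumed for \<open>k \<ge> 1\<close> only. For
        \<open>k = 0\<close> the one class is the whole space.\<close>
      proof (cases "k = 0")
        case True
        then have "?C = Zpn p n"
          using v reduce_in_residue_vecs[OF p_gt_1, of _ n 0] card_residue_vecs[OF p_gt_1, of 0 n]
          by (auto simp: card_1_singleton_iff)
        then have "A \<inter> ?C = A" using inv space_haar[OF n] by blast
        then show ?thesis using True by simp
      next
        case False
        then have "transitive_mod p k n F" by (intro trans) simp
        from measure_invariant_Int_residue_class[OF n F mp this A _ v] inv
        show ?thesis by (simp only: space_haar[OF n])
      qed
      then show "measure (uniform_measure (haar p n) A) ?C = 1 / real ((p ^ n) ^ k)"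
        using C A False pos by (simp add: measure_uniform_measure emeasure_eq_measure)
    qed (simp_all add: space_haar[OF n] U.finite_measure_axioms)
    \<comment> \<open>Both measures are evaluated at \<open>A\<close> itself, to which the
      conditioned one gives mass 1.\<close>
    then have "emeasure (haar p n) A = emeasure (uniform_measure (haar p n) A) A" by simp
    also have "\<dots> = 1"
      using A pos by (simp add: emeasure_eq_measure divide_ennreal zero_less_measure_iff)
    finally show ?thesis by simp
  qed simp
  with mp show ?thesis by (simp add: ergodic_def)
qed

end

theorem theorem1p2:
  fixes p n m :: nat and F :: "padic_vec \<Rightarrow> padic_vec"
  assumes "prime p" and "0 < m" and "m \<le> n" and "compatible p n m F"
  shows "(m = 1 \<and> n = 1 \<longrightarrow>
            (measure_preserving (haar p n) (haar p m) F \<longleftrightarrow> (\<forall>k\<ge>1. bijective_mod p k n F)) \<and>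
            (ergodic (haar p n) F \<longleftrightarrow> (\<forall>k\<ge>1. transitive_mod p k n F))) \<and>
         (measure_preserving (haar p n) (haar p m) F \<longleftrightarrow> (\<forall>k\<ge>1. balanced_mod p k n m F))"
proof (intro conjI impI)
  have p: "1 < p" using assms(1) by (rule prime_gt_1_nat)
  have n: "0 < n" using assms by simp
  show "measure_preserving (haar p n) (haar p m) F \<longleftrightarrow> (\<forall>k\<ge>1. balanced_mod p k n m F)"
    using measure_preserving_iff_balanced_mod[OF p n assms(2,4)] .
  assume "m = 1 \<and> n = 1"
  then have mn: "m = n" by simp
  then have F: "compatible p n n F" using assms by simp
  show "measure_preserving (haar p n) (haar p m) F \<longleftrightarrow> (\<forall>k\<ge>1. bijective_mod p k n F)"
    unfolding mn by (rule measure_preserving_iff_bijective_mod[OF p n F])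
  show "ergodic (haar p n) F \<longleftrightarrow> (\<forall>k\<ge>1. transitive_mod p k n F)"
    using ergodic_imp_transitive_mod[OF p n F] transitive_mod_imp_ergodic[OF p n F] by blast
qed

end
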